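(* Let $G$ be a finite connected graph with at least two edges. Then $$\sup_{(g,\rho)\in\mathcal{A}_+(G)}\overline{\lambda_1}(g,\rho)=\infty,\qquad\text{where } \overline{\lambda_1}(g,\rho):=\lambda_1(g,\rho)\,L(g)\int_{(G,g)}\rho\,dx_g .$$
   Context: $G=(V,E)$ is a finite connected discrete graph (loops and multiple edges allowed). A metric on $G$ is a vector $g=(g_e)_{e\in E}\in\mathbb{R}_+^{|E|}$ of positive numbers; the edge $e$ has length $\ell_e=\sqrt{g_e}$ and is identified with $[0,\ell_e]$, making $(G,g)$ a compact metric (quantum) graph of total length $L(g)=\sum_e\ell_e$. $dx_g$ is the arclength measure on $(G,g)$ and $\Delta_gf=-f''$ with derivatives in arclength. $\mathcal{C}_+(G)$ is the set of densities: functions $\rho$, positive and smooth on each closed edge (smooth up to the endpoints; no continuity across vertices required). $\mathcal{A}_+(G)=\mathbb{R}_+^{|E|}\times\mathcal{C}_+(G)$. For $(g,\rho)\in\mathcal{A}_+(G)$, $0=\lambda_0(g,\rho)<\lambda_1(g,\rho)\le\lambda_2(g,\rho)\le\cdots$ are the eigenvalues (with multiplicity) of: $\Delta_gf=\lambda\rho f$ on edges; $f$ continuous on $(G,g)$; $\sum_{e\in E_v}f_e'(v)=0$ at every vertex $v$, where $E_v$ is the set of edges attached at $v$ (a loop contributes both its ends) and $f'_e(v)$ is the derivative at $v$ pointing out of $v$ into $e$. *)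

theory Defs
  imports
    "HOL-Analysis.Analysis"
    "HOL-Library.Function_Algebras"
    "Graph_Theory.Digraph_Component"
begin

text \<open>
  A finite graph with loops and multiple edges is a \<^locale>\<open>fin_digraph\<close>: the direction of an arc
  only records the identification of the edge \<open>e\<close> with \<open>[0, \<ell> e]\<close>, where \<open>0\<close> is the end at
  \<open>tail G e\<close> and \<open>\<ell> e\<close> the end at \<open>head G e\<close>.
\<close>

definition edge_length :: "('e \<Rightarrow> real) \<Rightarrow> 'e \<Rightarrow> real" where
  "edge_length g e = sqrt (g e)"

definition total_length :: "('v, 'e) pre_digraph \<Rightarrow> ('e \<Rightarrow> real) \<Rightarrow> real" where
  "total_length G g = (\<Sum>e\<in>arcs G. edge_length g e)"

definition metrics :: "('v, 'e) pre_digraph \<Rightarrow> ('e \<Rightarrow> real) set" where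
  "metrics G = {g. \<forall>e\<in>arcs G. g e > 0}"

text \<open>Infinitely differentiable on a closed interval, with one-sided derivatives at its ends.\<close>

definition smooth_on_interval :: "real \<Rightarrow> real \<Rightarrow> (real \<Rightarrow> real) \<Rightarrow> bool" where
  "smooth_on_interval a b h \<longleftrightarrow>
     (\<exists>D :: nat \<Rightarrow> real \<Rightarrow> real. (\<forall>x\<in>{a..b}. D 0 x = h x) \<and>
        (\<forall>n. \<forall>x\<in>{a..b}. (D n has_real_derivative D (Suc n) x) (at x within {a..b})))"

text \<open>
  The set of densities does not depend on the metric, so a density is given on each edge in the
  affine coordinate \<open>t \<in> [0, 1]\<close>; its value at the point with arclength coordinate \<open>x\<close> is then
  obtained at \<open>t = x / \<ell> e\<close>.
\<close>

definition densities :: "('v, 'e) pre_digraph \<Rightarrow> ('e \<Rightarrow> real \<Rightarrow> real) set" where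
  "densities G = {\<rho>. \<forall>e\<in>arcs G. smooth_on_interval 0 1 (\<rho> e) \<and> (\<forall>t\<in>{0..1}. \<rho> e t > 0)}"

definition admissible :: "('v, 'e) pre_digraph \<Rightarrow> (('e \<Rightarrow> real) \<times> ('e \<Rightarrow> real \<Rightarrow> real)) set" where
  "admissible G = metrics G \<times> densities G"

definition arclength_density ::
    "('e \<Rightarrow> real) \<Rightarrow> ('e \<Rightarrow> real \<Rightarrow> real) \<Rightarrow> 'e \<Rightarrow> real \<Rightarrow> real" where
  "arclength_density g \<rho> e x = \<rho> e (x / edge_length g e)"

definition total_mass ::
    "('v, 'e) pre_digraph \<Rightarrow> ('e \<Rightarrow> real) \<Rightarrow> ('e \<Rightarrow> real \<Rightarrow> real) \<Rightarrow> real" where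
  "total_mass G g \<rho> = (\<Sum>e\<in>arcs G. integral {0..edge_length g e} (arclength_density g \<rho> e))"

text \<open>
  A function on the metric graph is represented in arclength coordinates by
  \<open>f :: 'e \<Rightarrow> real \<Rightarrow> real\<close>. It is required to vanish off the edges, so that the representation is
  unique and dimensions of function spaces are the intended ones. The value of \<open>f\<close> at the vertex
  \<open>v\<close> is \<open>\<phi> v\<close>. In the vertex condition \<open>f'\<close> points out of the tail and into the head, whence the
  sign; a loop at \<open>v\<close> occurs in both sums.
\<close>

definition eigenspace ::
    "('v, 'e) pre_digraph \<Rightarrow> ('e \<Rightarrow> real) \<Rightarrow> ('e \<Rightarrow> real \<Rightarrow> real) \<Rightarrow> real
      \<Rightarrow> ('e \<Rightarrow> real \<Rightarrow> real) set" where
  "eigenspace G g \<rho> \<mu> = {f.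
     (\<forall>e x. \<not> (e \<in> arcs G \<and> x \<in> {0..edge_length g e}) \<longrightarrow> f e x = 0) \<and>
     (\<exists>\<phi> :: 'v \<Rightarrow> real. \<forall>e\<in>arcs G.
        f e 0 = \<phi> (tail G e) \<and> f e (edge_length g e) = \<phi> (head G e)) \<and>
     (\<exists>f' :: 'e \<Rightarrow> real \<Rightarrow> real.
        (\<forall>e\<in>arcs G. \<forall>x\<in>{0..edge_length g e}.
           (f e has_real_derivative f' e x) (at x within {0..edge_length g e}) \<and>
           (f' e has_real_derivative - (\<mu> * arclength_density g \<rho> e x * f e x))
             (at x within {0..edge_length g e})) \<and>
        (\<forall>v\<in>verts G.
           (\<Sum>e | e \<in> arcs G \<and> tail G e = v. f' e 0)
           + (\<Sum>e | e \<in> arcs G \<and> head G e = v. - f' e (edge_length g e)) = 0))}"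

global_interpretation graph_fun: vector_space
    "\<lambda>(c :: real) (f :: 'e \<Rightarrow> real \<Rightarrow> real) e x. c * f e x"
  by unfold_locales (simp_all add: fun_eq_iff algebra_simps)

definition multiplicity_of ::
    "('v, 'e) pre_digraph \<Rightarrow> ('e \<Rightarrow> real) \<Rightarrow> ('e \<Rightarrow> real \<Rightarrow> real) \<Rightarrow> real \<Rightarrow> nat" where
  "multiplicity_of G g \<rho> \<mu> = graph_fun.dim (eigenspace G g \<rho> \<mu>)"

text \<open>
  The \<open>k\<close>-th eigenvalue, counted from \<open>0\<close> and with multiplicity, is the least \<open>c\<close> such that the
  eigenvalues not exceeding \<open>c\<close> have total multiplicity greater than \<open>k\<close>. (Numbers that are not
  eigenvalues have multiplicity \<open>0\<close>; eigenspaces are finite-dimensional, an element being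
  determined by \<open>f e 0\<close> and \<open>f' e 0\<close> for all edges \<open>e\<close>.)
\<close>

definition nth_eigenvalue ::
    "('v, 'e) pre_digraph \<Rightarrow> nat \<Rightarrow> ('e \<Rightarrow> real) \<Rightarrow> ('e \<Rightarrow> real \<Rightarrow> real) \<Rightarrow> real" where
  "nth_eigenvalue G k g \<rho> =
     Inf {c. \<exists>M. finite M \<and> M \<subseteq> {..c} \<and> k < (\<Sum>\<mu>\<in>M. multiplicity_of G g \<rho> \<mu>)}"

definition normalized_eigenvalue ::
    "('v, 'e) pre_digraph \<Rightarrow> nat \<Rightarrow> ('e \<Rightarrow> real) \<Rightarrow> ('e \<Rightarrow> real \<Rightarrow> real) \<Rightarrow> real" where
  "normalized_eigenvalue G k g \<rho> =
     nth_eigenvalue G k g \<rho> * total_length G g * total_mass G g \<rho>"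

end

theory Submission
  imports Defs
begin

text \<open>
  Put mass \<open>1\<close> on one edge \<open>b\<close> of length \<open>\<delta>\<close>, and let all other edges have length \<open>1\<close> and mass \<open>\<delta>\<close>.
  Let \<open>f\<close> be an eigenfunction with eigenvalue \<open>\<mu> > 0\<close> and energy \<open>E\<close>, the integral of \<open>f'\<^sup>2\<close>. It has mean
  zero, so \<open>E\<close> is at most \<open>\<mu>\<close> times the weighted integral of \<open>(f - r)\<^sup>2\<close>, where \<open>r\<close> is the value of \<open>f\<close> at
  an end of \<open>b\<close>. On \<open>b\<close> the deviation \<open>(f - r)\<^sup>2\<close> is at most \<open>\<delta> * E\<close> because \<open>b\<close> is short; on the other
  edges it is at most a constant times \<open>E\<close>, but these carry only mass \<open>\<delta>\<close>. Hence \<open>E \<le> C * \<delta> * \<mu> * E\<close>,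
  that is \<open>\<mu> \<ge> 1 / (C * \<delta>)\<close>, while total length and total mass are at least \<open>1\<close>.
\<close>

section \<open>Calculus on one edge, and a dimension criterion\<close>

text \<open>Cauchy-Schwarz for h y - h x as the integral of h', obtained by expanding the integral
  of (h' - m)^2 >= 0 with m the mean slope between the two points. The factor \<open>l\<close> is
  what makes a short edge nearly rigid.\<close>

lemma square_diff_le_energy:
  fixes h h' :: "real \<Rightarrow> real"
  assumes deriv: "\<And>x. x \<in> {0..l} \<Longrightarrow> (h has_real_derivative h' x) (at x within {0..l})"
    and cont: "continuous_on {0..l} h'"
    and x: "x \<in> {0..l}" and y: "y \<in> {0..l}"
  shows "(h y - h x)\<^sup>2 \<le> l * integral {0..l} (\<lambda>t. (h' t)\<^sup>2)"
proof -
  have *: "(h y - h x)\<^sup>2 \<le> l * integral {0..l} (\<lambda>t. (h' t)\<^sup>2)"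
    if x: "x \<in> {0..l}" and y: "y \<in> {0..l}" and "x < y" for x y
  proof -
    define m where "m = (h y - h x) / (y - x)"
    have sub: "{x..y} \<subseteq> {0..l}" using x y by auto
    have int0: "(\<lambda>t. (h' t)\<^sup>2) integrable_on {0..l}"
      by (intro integrable_continuous_real continuous_intros cont)
    have int1: "(\<lambda>t. (h' t)\<^sup>2) integrable_on {x..y}"
      by (intro integrable_continuous_real continuous_intros continuous_on_subset[OF cont sub])
    have "(h' has_integral (h y - h x)) {x..y}"
      using \<open>x < y\<close> sub
      by (intro fundamental_theorem_of_calculus)
         (auto simp flip: has_real_derivative_iff_has_vector_derivative
               intro!: has_field_derivative_subset[OF deriv sub])
    moreover have "((\<lambda>t. m\<^sup>2) has_integral (m\<^sup>2 * (y - x))) {x..y}"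
      using has_integral_const_real[of "m\<^sup>2" x y] \<open>x < y\<close> by (simp add: mult.commute)
    ultimately have "((\<lambda>t. (h' t)\<^sup>2 - 2 * m * h' t + m\<^sup>2) has_integral
        (integral {x..y} (\<lambda>t. (h' t)\<^sup>2) - 2 * m * (h y - h x) + m\<^sup>2 * (y - x))) {x..y}"
      using int1 by (intro has_integral_add has_integral_diff has_integral_mult_right) auto
    moreover have "(\<lambda>t. (h' t)\<^sup>2 - 2 * m * h' t + m\<^sup>2) = (\<lambda>t. (h' t - m)\<^sup>2)"
      by (auto simp: power2_eq_square algebra_simps)
    ultimately have "0 \<le> integral {x..y} (\<lambda>t. (h' t)\<^sup>2) - 2 * m * (h y - h x) + m\<^sup>2 * (y - x)"
      by (metis (no_types, lifting) has_integral_nonneg zero_le_power2)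
    moreover have "h y - h x = m * (y - x)"
      using \<open>x < y\<close> by (simp add: m_def)
    ultimately have "m\<^sup>2 * (y - x) \<le> integral {x..y} (\<lambda>t. (h' t)\<^sup>2)"
      by (simp add: power2_eq_square algebra_simps)
    also have "\<dots> \<le> integral {0..l} (\<lambda>t. (h' t)\<^sup>2)"
      using sub int0 int1 by (intro integral_subset_le) auto
    finally have "(y - x) * (m\<^sup>2 * (y - x)) \<le> l * integral {0..l} (\<lambda>t. (h' t)\<^sup>2)"
      using x y \<open>x < y\<close> by (intro mult_mono) auto
    moreover have "(h y - h x)\<^sup>2 = (y - x) * (m\<^sup>2 * (y - x))"
      unfolding \<open>h y - h x = m * (y - x)\<close> by (simp add: power2_eq_square)
    ultimately show ?thesis by simp
  qed
  have "0 \<le> l * integral {0..l} (\<lambda>t. (h' t)\<^sup>2)"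
    using x by (intro mult_nonneg_nonneg integral_nonneg integrable_continuous_real
        continuous_intros cont) auto
  then show ?thesis
    using *[OF x y] *[OF y x] by (cases x y rule: linorder_cases) (auto simp: power2_commute)
qed

lemma harmonic_oscillator_unique:
  fixes h h' :: "real \<Rightarrow> real"
  assumes h: "\<And>x. x \<in> {0..l} \<Longrightarrow> (h has_real_derivative h' x) (at x within {0..l})"
    and h': "\<And>x. x \<in> {0..l} \<Longrightarrow> (h' has_real_derivative - (k\<^sup>2 * h x)) (at x within {0..l})"
    and "k \<noteq> 0" and x: "x \<in> {0..l}"
  shows "h x = h 0 * cos (k * x) + h' 0 / k * sin (k * x)"
proof -
  \<comment> \<open>\<open>u\<close> and \<open>v\<close> are the coordinates of the phase vector
    (h, h'/k) in a frame rotating with the oscillator. They are constant along solutions, with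
    values h 0 and h' 0 / k, and rotating back recovers h.\<close>
  define u where "u x = h x * cos (k * x) - h' x / k * sin (k * x)" for x
  define v where "v x = h x * sin (k * x) + h' x / k * cos (k * x)" for x
  have "(u has_real_derivative 0) (at t within {0..l})" if "t \<in> {0..l}" for t
    unfolding u_def using \<open>k \<noteq> 0\<close>
    by (auto intro!: derivative_eq_intros h[OF that] h'[OF that] simp: power2_eq_square field_simps)
  then obtain c where c: "\<And>t. t \<in> {0..l} \<Longrightarrow> u t = c"
    using has_field_derivative_zero_constant[of "{0..l}" u] by auto
  have "(v has_real_derivative 0) (at t within {0..l})" if "t \<in> {0..l}" for t
    unfolding v_def using \<open>k \<noteq> 0\<close>
    by (auto intro!: derivative_eq_intros h[OF that] h'[OF that] simp: power2_eq_square field_simps)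
  then obtain d where d: "\<And>t. t \<in> {0..l} \<Longrightarrow> v t = d"
    using has_field_derivative_zero_constant[of "{0..l}" v] by auto
  have 0: "0 \<in> {0..l}" using x by auto
  have "h x * ((cos (k * x))\<^sup>2 + (sin (k * x))\<^sup>2) = u x * cos (k * x) + v x * sin (k * x)"
    unfolding u_def v_def power2_eq_square by algebra
  then have "h x = u x * cos (k * x) + v x * sin (k * x)"
    by simp
  also have "u x = u 0" using c 0 x by metis
  also have "v x = v 0" using d 0 x by metis
  finally show ?thesis by (simp add: u_def v_def)
qed

text \<open>The finiteness matters: the dimension of an infinite-dimensional space is \<open>0\<close> by convention.\<close>

lemma dim_pos_if_finite_span:
  assumes "finite B" "S \<subseteq> graph_fun.span B" "f \<in> S" "f \<noteq> 0"
  shows "0 < graph_fun.dim S"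
proof (rule ccontr)
  assume "\<not> 0 < graph_fun.dim S"
  moreover obtain A where A: "A \<subseteq> S" "graph_fun.independent A" "S \<subseteq> graph_fun.span A"
      "card A = graph_fun.dim S"
    by (rule graph_fun.basis_exists)
  moreover have "finite A"
    using graph_fun.independent_span_bound[of B A] assms A by blast
  ultimately have "A = {}" by simp
  then show False using A(3) assms by auto
qed

section \<open>Discrete estimates on the vertices\<close>

text \<open>A walk of n edges changes \<phi> by at most n * s. The constant \<open>N\<close> is
  chosen before \<phi> and s, so later it does not depend on \<delta>.\<close>

lemma connected_variation_bound:
  assumes "fin_digraph G" "Digraph_Component.connected G"
  obtains N :: real where "N \<ge> 0"
    "\<And>(\<phi> :: 'v \<Rightarrow> real) s u v. \<lbrakk>\<And>e. e \<in> arcs G \<Longrightarrow> \<bar>\<phi> (head G e) - \<phi> (tail G e)\<bar> \<le> s; s \<ge> 0;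
       u \<in> verts G; v \<in> verts G\<rbrakk> \<Longrightarrow> \<bar>\<phi> u - \<phi> v\<bar> \<le> N * s"
proof -
  interpret fin_digraph G by fact
  define P where "P n u v \<longleftrightarrow> (\<forall>(\<phi> :: 'v \<Rightarrow> real) s.
      (\<forall>e\<in>arcs G. \<bar>\<phi> (head G e) - \<phi> (tail G e)\<bar> \<le> s) \<longrightarrow> s \<ge> 0 \<longrightarrow> \<bar>\<phi> u - \<phi> v\<bar> \<le> real n * s)"
    for n u v
  have "\<exists>n. P n u v" if "u \<in> verts G" "v \<in> verts G" for u v
  proof -
    have "u \<rightarrow>\<^sup>*\<^bsub>mk_symmetric G\<^esub> v"
      using assms that by (auto simp: Digraph_Component.connected_def strongly_connected_def)
    then show ?thesis
      unfolding reachable_def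
    proof (induction rule: rtrancl_on_induct)
      case base
      have "P 0 u u" by (simp add: P_def)
      then show ?case ..
    next
      case (step x y)
      then obtain n where n: "P n u x" by blast
      \<comment> \<open>A step in the symmetrized graph may run against the arc; the absolute value
        does not see the direction.\<close>
      from step obtain e where "e \<in> arcs G" "(x, y) = (tail G e, head G e) \<or> (x, y) = (head G e, tail G e)"
        by (auto simp: parcs_mk_symmetric)
      then have "\<bar>\<phi> x - \<phi> y\<bar> \<le> s" if "\<forall>e\<in>arcs G. \<bar>\<phi> (head G e) - \<phi> (tail G e)\<bar> \<le> s" for \<phi> :: "'v \<Rightarrow> real" and s
        using that by (auto simp: abs_minus_commute)
      note xy = this
      have "P (Suc n) u y"
        unfolding P_def
      proof (intro allI impI)
        fix \<phi> :: "'v \<Rightarrow> real" and s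
        assume *: "\<forall>e\<in>arcs G. \<bar>\<phi> (head G e) - \<phi> (tail G e)\<bar> \<le> s" "s \<ge> 0"
        then have "\<bar>\<phi> u - \<phi> x\<bar> \<le> real n * s" using n by (simp add: P_def)
        with xy[OF *(1)] show "\<bar>\<phi> u - \<phi> y\<bar> \<le> real (Suc n) * s"
          by (simp add: algebra_simps)
      qed
      then show ?case ..
    qed
  qed
  then obtain n where n: "\<And>u v. u \<in> verts G \<Longrightarrow> v \<in> verts G \<Longrightarrow> P (n u v) u v"
    by metis
  \<comment> \<open>The sum of all the walk lengths is a crude bound for their maximum over the
    finitely many pairs.\<close>
  define N where "N = real (\<Sum>u\<in>verts G. \<Sum>v\<in>verts G. n u v)"
  show thesis
  proof (rule that[of N])
    fix \<phi> :: "'v \<Rightarrow> real" and s u v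
    assume *: "\<And>e. e \<in> arcs G \<Longrightarrow> \<bar>\<phi> (head G e) - \<phi> (tail G e)\<bar> \<le> s" "s \<ge> 0"
      and uv: "u \<in> verts G" "v \<in> verts G"
    have "n u v \<le> (\<Sum>v\<in>verts G. n u v)"
      using uv by (intro member_le_sum) auto
    also have "\<dots> \<le> (\<Sum>u\<in>verts G. \<Sum>v\<in>verts G. n u v)"
      using uv by (intro member_le_sum[of u]) auto
    finally have "real (n u v) * s \<le> N * s"
      unfolding N_def using \<open>s \<ge> 0\<close> by (intro mult_right_mono of_nat_mono)
    moreover have "\<bar>\<phi> u - \<phi> v\<bar> \<le> real (n u v) * s"
      using n[OF uv] * unfolding P_def by blast
    ultimately show "\<bar>\<phi> u - \<phi> v\<bar> \<le> N * s" by simp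
  qed (auto simp: N_def intro!: sum_nonneg)
qed

text \<open>Summation by parts: grouping the edge ends by vertex gives \<phi> v times the Kirchhoff
  sum at v. It is applied to the vertex values of an eigenfunction, for the energy, and to \<phi> =
  1, for the mean.\<close>

lemma kirchhoff_flux_zero:
  fixes p q :: "'e \<Rightarrow> real" and \<phi> :: "'v \<Rightarrow> real"
  assumes "fin_digraph G"
    and "\<And>v. v \<in> verts G \<Longrightarrow> (\<Sum>e | e \<in> arcs G \<and> tail G e = v. p e)
           + (\<Sum>e | e \<in> arcs G \<and> head G e = v. - q e) = 0"
  shows "(\<Sum>e\<in>arcs G. \<phi> (head G e) * q e - \<phi> (tail G e) * p e) = 0"
proof -
  interpret fin_digraph G by fact
  have "(\<Sum>e\<in>arcs G. \<phi> (t e) * r e) = (\<Sum>v\<in>verts G. \<phi> v * (\<Sum>e | e \<in> arcs G \<and> t e = v. r e))"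
    if "\<And>e. e \<in> arcs G \<Longrightarrow> t e \<in> verts G" for t and r :: "'e \<Rightarrow> real"
  proof -
    have "(\<Sum>e\<in>arcs G. \<phi> (t e) * r e) = (\<Sum>v\<in>verts G. \<Sum>e | e \<in> arcs G \<and> t e = v. \<phi> (t e) * r e)"
      using that by (intro sum.group[symmetric]) auto
    then show ?thesis by (simp add: sum_distrib_left)
  qed
  note this[of "tail G" p] this[of "head G" q]
  then have "(\<Sum>e\<in>arcs G. \<phi> (head G e) * q e - \<phi> (tail G e) * p e) =
     - (\<Sum>v\<in>verts G. \<phi> v * ((\<Sum>e | e \<in> arcs G \<and> tail G e = v. p e)
           + (\<Sum>e | e \<in> arcs G \<and> head G e = v. - q e)))"
    by (simp add: sum_subtractf sum_negf distrib_left right_diff_distrib sum.distrib)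
  then show ?thesis using assms(2) by simp
qed

section \<open>Green's identities for eigenfunctions\<close>

text \<open>The equation is tested with f and with 1: integrating (f f')' and f'' over each edge
  leaves boundary terms that cancel at the vertices. The second identity keeps its factor \<mu>,
  since for \<mu> = 0 the mean is free.\<close>

lemma eigenspace_energyE:
  fixes G :: "('v, 'e) pre_digraph"
  assumes "fin_digraph G" "g \<in> metrics G" "f \<in> eigenspace G g \<rho> \<mu>"
  obtains \<phi> :: "'v \<Rightarrow> real" and f' :: "'e \<Rightarrow> real \<Rightarrow> real" where
    "\<And>e x. e \<in> arcs G \<Longrightarrow> x \<in> {0..edge_length g e} \<Longrightarrow>
       (f e has_real_derivative f' e x) (at x within {0..edge_length g e})"
    "\<And>e x. e \<in> arcs G \<Longrightarrow> x \<in> {0..edge_length g e} \<Longrightarrow>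
       (f' e has_real_derivative - (\<mu> * arclength_density g \<rho> e x * f e x))
         (at x within {0..edge_length g e})"
    "\<And>e. e \<in> arcs G \<Longrightarrow> f e 0 = \<phi> (tail G e)"
    "\<And>e. e \<in> arcs G \<Longrightarrow> f e (edge_length g e) = \<phi> (head G e)"
    "(\<Sum>e\<in>arcs G. integral {0..edge_length g e} (\<lambda>x. (f' e x)\<^sup>2)) =
       \<mu> * (\<Sum>e\<in>arcs G. integral {0..edge_length g e} (\<lambda>x. arclength_density g \<rho> e x * (f e x)\<^sup>2))"
    "\<mu> * (\<Sum>e\<in>arcs G. integral {0..edge_length g e} (\<lambda>x. arclength_density g \<rho> e x * f e x)) = 0"
proof -
  let ?l = "edge_length g" and ?\<rho> = "arclength_density g \<rho>"
  from assms(3) obtain \<phi> :: "'v \<Rightarrow> real" and f' :: "'e \<Rightarrow> real \<Rightarrow> real" where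
    \<phi>: "\<And>e. e \<in> arcs G \<Longrightarrow> f e 0 = \<phi> (tail G e)" "\<And>e. e \<in> arcs G \<Longrightarrow> f e (?l e) = \<phi> (head G e)"
    and f: "\<And>e x. e \<in> arcs G \<Longrightarrow> x \<in> {0..?l e} \<Longrightarrow>
       (f e has_real_derivative f' e x) (at x within {0..?l e})"
    and f': "\<And>e x. e \<in> arcs G \<Longrightarrow> x \<in> {0..?l e} \<Longrightarrow>
       (f' e has_real_derivative - (\<mu> * ?\<rho> e x * f e x)) (at x within {0..?l e})"
    and kirchhoff: "\<And>v. v \<in> verts G \<Longrightarrow> (\<Sum>e | e \<in> arcs G \<and> tail G e = v. f' e 0)
           + (\<Sum>e | e \<in> arcs G \<and> head G e = v. - f' e (?l e)) = 0"
    unfolding eigenspace_def by blast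
  have l: "?l e \<ge> 0" if "e \<in> arcs G" for e
    using assms(2) that by (auto simp: metrics_def edge_length_def intro: less_imp_le)
  have green: "integral {0..?l e} (\<lambda>x. (f' e x)\<^sup>2) - \<mu> * integral {0..?l e} (\<lambda>x. ?\<rho> e x * (f e x)\<^sup>2)
      = \<phi> (head G e) * f' e (?l e) - \<phi> (tail G e) * f' e 0" if e: "e \<in> arcs G" for e
  proof -
    have "((\<lambda>x. f e x * f' e x) has_real_derivative (f' e x)\<^sup>2 - \<mu> * (?\<rho> e x * (f e x)\<^sup>2))
        (at x within {0..?l e})" if "x \<in> {0..?l e}" for x
      by (rule derivative_eq_intros f[OF e that] f'[OF e that] refl)+
         (simp add: power2_eq_square algebra_simps)
    then have 1: "((\<lambda>x. (f' e x)\<^sup>2 - \<mu> * (?\<rho> e x * (f e x)\<^sup>2)) has_integral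
        (f e (?l e) * f' e (?l e) - f e 0 * f' e 0)) {0..?l e}"
      using l[OF e]
      by (intro fundamental_theorem_of_calculus)
         (auto simp flip: has_real_derivative_iff_has_vector_derivative)
    have "continuous_on {0..?l e} (f' e)"
      by (rule DERIV_continuous_on) (rule f'[OF e])
    then have 2: "(\<lambda>x. (f' e x)\<^sup>2) integrable_on {0..?l e}"
      by (intro integrable_continuous_real continuous_intros)
    \<comment> \<open>\<open>\<rho>\<close> is arbitrary here, so integrability of the weighted term
      comes from writing it as the difference of two integrable functions.\<close>
    have "((\<lambda>x. \<mu> * (?\<rho> e x * (f e x)\<^sup>2)) has_integral (integral {0..?l e} (\<lambda>x. (f' e x)\<^sup>2)
        - (f e (?l e) * f' e (?l e) - f e 0 * f' e 0))) {0..?l e}"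
      using has_integral_diff[OF integrable_integral[OF 2] 1] by simp
    from integral_unique[OF this] show ?thesis by (simp add: \<phi> e)
  qed
  \<comment> \<open>The factors 1 are the constant potential in
    \<open>kirchhoff_flux_zero\<close>.\<close>
  have flux: "- (\<mu> * integral {0..?l e} (\<lambda>x. ?\<rho> e x * f e x)) = 1 * f' e (?l e) - 1 * f' e 0"
    if e: "e \<in> arcs G" for e
  proof -
    have "((\<lambda>x. - \<mu> * (?\<rho> e x * f e x)) has_integral (f' e (?l e) - f' e 0)) {0..?l e}"
      using l[OF e] f'[OF e]
      by (intro fundamental_theorem_of_calculus)
         (auto simp flip: has_real_derivative_iff_has_vector_derivative simp: mult.assoc)
    from integral_unique[OF this] show ?thesis by simp
  qed
  have "(\<Sum>e\<in>arcs G. integral {0..?l e} (\<lambda>x. (f' e x)\<^sup>2)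
      - \<mu> * integral {0..?l e} (\<lambda>x. ?\<rho> e x * (f e x)\<^sup>2)) = 0"
    using kirchhoff_flux_zero[of G "\<lambda>e. f' e 0" "\<lambda>e. f' e (?l e)" \<phi>] assms(1) kirchhoff
    by (simp add: green)
  moreover have "(\<Sum>e\<in>arcs G. - (\<mu> * integral {0..?l e} (\<lambda>x. ?\<rho> e x * f e x))) = 0"
    using kirchhoff_flux_zero[of G "\<lambda>e. f' e 0" "\<lambda>e. f' e (?l e)" "\<lambda>_. 1"] assms(1) kirchhoff
    by (simp add: flux)
  ultimately show thesis
    by (intro that[of f' \<phi>] f f' \<phi>) (auto simp: sum_subtractf sum_negf sum_distrib_left)
qed

section \<open>The spike family of metrics and densities\<close>

text \<open>A metric records squared lengths, so \<open>b\<close> gets length \<delta>.\<close>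

definition spike_metric :: "'e \<Rightarrow> real \<Rightarrow> 'e \<Rightarrow> real" where
  "spike_metric b \<delta> e = (if e = b then \<delta>\<^sup>2 else 1)"

definition spike_density :: "'e \<Rightarrow> real \<Rightarrow> 'e \<Rightarrow> real \<Rightarrow> real" where
  "spike_density b \<delta> e t = (if e = b then 1 / \<delta> else \<delta>)"

text \<open>Cutting off outside the edges meets the normalization required in
  \<open>eigenspace\<close>.\<close>

definition edge_fun ::
    "('v, 'e) pre_digraph \<Rightarrow> ('e \<Rightarrow> real) \<Rightarrow> ('e \<Rightarrow> real \<Rightarrow> real) \<Rightarrow> 'e \<Rightarrow> real \<Rightarrow> real" where
  "edge_fun G g h e x = (if e \<in> arcs G \<and> x \<in> {0..edge_length g e} then h e x else 0)"

lemma edge_length_spike: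
  "\<delta> > 0 \<Longrightarrow> edge_length (spike_metric b \<delta>) e = (if e = b then \<delta> else 1)"
  by (simp add: edge_length_def spike_metric_def)

lemma edge_length_spike_pos: "\<delta> > 0 \<Longrightarrow> edge_length (spike_metric b \<delta>) e > 0"
  by (simp add: edge_length_spike)

text \<open>
  With densities \<open>\<delta> / \<ell>\<^sup>2\<close> all edges resonate at a common frequency, so \<open>cos (2 * pi * x / \<ell>)\<close> is an
  explicit eigenfunction. Some nonconstant eigenfunction must be exhibited: otherwise
  \<^const>\<open>nth_eigenvalue\<close> might be the infimum of the empty set.
\<close>

lemma arclength_density_spike:
  "\<delta> > 0 \<Longrightarrow> arclength_density (spike_metric b \<delta>) (spike_density b \<delta>) e x
     = \<delta> / (edge_length (spike_metric b \<delta>) e)\<^sup>2"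
  by (simp add: arclength_density_def spike_density_def edge_length_spike power2_eq_square)

lemma spike_metric_in_metrics: "\<delta> > 0 \<Longrightarrow> spike_metric b \<delta> \<in> metrics G"
  by (simp add: metrics_def spike_metric_def)

lemma spike_admissible:
  assumes "\<delta> > 0"
  shows "(spike_metric b \<delta>, spike_density b \<delta>) \<in> admissible G"
proof -
  have "smooth_on_interval 0 1 (spike_density b \<delta> e)" for e
    unfolding smooth_on_interval_def
    by (rule exI[of _ "\<lambda>n. if n = 0 then spike_density b \<delta> e else (\<lambda>_. 0)"])
       (auto simp: spike_density_def[abs_def])
  with assms show ?thesis
    by (auto simp: admissible_def spike_metric_in_metrics densities_def spike_density_def)
qed

text \<open>Derivatives are taken within the closed edge, so the cut-off does not affect them, not
  even at the ends.\<close>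

lemma edge_funI_eigenspace:
  fixes G :: "('v, 'e) pre_digraph" and \<phi> :: "'v \<Rightarrow> real"
  assumes g: "g \<in> metrics G"
    and h: "\<And>e x. e \<in> arcs G \<Longrightarrow> x \<in> {0..edge_length g e} \<Longrightarrow>
       (h e has_real_derivative h' e x) (at x within {0..edge_length g e})"
    and h': "\<And>e x. e \<in> arcs G \<Longrightarrow> x \<in> {0..edge_length g e} \<Longrightarrow>
       (h' e has_real_derivative - (\<mu> * arclength_density g \<rho> e x * h e x))
         (at x within {0..edge_length g e})"
    and \<phi>: "\<And>e. e \<in> arcs G \<Longrightarrow> h e 0 = \<phi> (tail G e)"
      "\<And>e. e \<in> arcs G \<Longrightarrow> h e (edge_length g e) = \<phi> (head G e)"
    and kirchhoff: "\<And>v. v \<in> verts G \<Longrightarrow> (\<Sum>e | e \<in> arcs G \<and> tail G e = v. h' e 0)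
           + (\<Sum>e | e \<in> arcs G \<and> head G e = v. - h' e (edge_length g e)) = 0"
  shows "edge_fun G g h \<in> eigenspace G g \<rho> \<mu>"
proof -
  have l: "edge_length g e \<ge> 0" if "e \<in> arcs G" for e
    using g that by (auto simp: metrics_def edge_length_def intro: less_imp_le)
  have "(edge_fun G g h e has_real_derivative h' e x) (at x within {0..edge_length g e})"
    if "e \<in> arcs G" "x \<in> {0..edge_length g e}" for e x
    using h[OF that] that unfolding has_field_derivative_def
    by (elim has_derivative_transform[rotated 2]) (auto simp: edge_fun_def)
  then show ?thesis
    unfolding eigenspace_def using l h' \<phi> kirchhoff
    by (intro CollectI conjI exI[of _ \<phi>] exI[of _ h']) (auto simp: edge_fun_def)
qed

section \<open>The spectral gap\<close>

text \<open>The gap in contrapositive form: below the threshold the energy E vanishes, which leaves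
  only constants, and these only for \<mu> = 0. All signs of \<mu> are covered, because the
  eigenvalue count ranges over all reals.\<close>

lemma spike_eigenfunction_constant:
  fixes G :: "('v, 'e) pre_digraph" and \<delta> N :: real
  assumes "fin_digraph G" and b: "b \<in> arcs G" and \<delta>: "\<delta> > 0" "\<delta> \<le> 1" and "N \<ge> 0"
    and N: "\<And>(\<phi> :: 'v \<Rightarrow> real) s u v. \<lbrakk>\<And>e. e \<in> arcs G \<Longrightarrow> \<bar>\<phi> (head G e) - \<phi> (tail G e)\<bar> \<le> s; s \<ge> 0;
       u \<in> verts G; v \<in> verts G\<rbrakk> \<Longrightarrow> \<bar>\<phi> u - \<phi> v\<bar> \<le> N * s"
    and f: "f \<in> eigenspace G (spike_metric b \<delta>) (spike_density b \<delta>) \<mu>"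
    and \<mu>: "\<mu> * (\<delta> * (card (arcs G) * (N + 1)\<^sup>2)) < 1"
  obtains r where "f = edge_fun G (spike_metric b \<delta>) (\<lambda>e x. r)" "\<mu> \<noteq> 0 \<longrightarrow> r = 0"
proof -
  interpret fin_digraph G by fact
  define g where "g = spike_metric b \<delta>"
  define c where "c e = \<delta> / (edge_length g e)\<^sup>2" for e
  let ?l = "edge_length g"
  have l: "0 < ?l e" "?l e \<le> 1" for e
    using \<delta> by (auto simp: g_def edge_length_spike)
  have c: "c e > 0" for e using \<delta> l[of e] by (simp add: c_def)
  have \<rho>: "arclength_density g (spike_density b \<delta>) e x = c e" for e x
    using \<delta> by (simp add: g_def c_def arclength_density_spike)
  have "g \<in> metrics G" using \<delta> by (simp add: g_def spike_metric_in_metrics)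
  note data = eigenspace_energyE[OF \<open>fin_digraph G\<close> this f[folded g_def], unfolded \<rho> integral_mult_right]
  obtain \<phi> :: "'v \<Rightarrow> real" and f' where
    f1: "\<And>e x. e \<in> arcs G \<Longrightarrow> x \<in> {0..?l e} \<Longrightarrow>
       (f e has_real_derivative f' e x) (at x within {0..?l e})"
    and f2: "\<And>e x. e \<in> arcs G \<Longrightarrow> x \<in> {0..?l e} \<Longrightarrow>
       (f' e has_real_derivative - (\<mu> * c e * f e x)) (at x within {0..?l e})"
    and \<phi>: "\<And>e. e \<in> arcs G \<Longrightarrow> f e 0 = \<phi> (tail G e)"
       "\<And>e. e \<in> arcs G \<Longrightarrow> f e (?l e) = \<phi> (head G e)"
    and energy: "(\<Sum>e\<in>arcs G. integral {0..?l e} (\<lambda>x. (f' e x)\<^sup>2)) =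
       \<mu> * (\<Sum>e\<in>arcs G. c e * integral {0..?l e} (\<lambda>x. (f e x)\<^sup>2))"
    and mean: "\<mu> * (\<Sum>e\<in>arcs G. c e * integral {0..?l e} (f e)) = 0"
    by (rule data) blast
  define E where "E = (\<Sum>e\<in>arcs G. integral {0..?l e} (\<lambda>x. (f' e x)\<^sup>2))"
  \<comment> \<open>The reference value is taken at an end of the heavy edge \<open>b\<close>, so
    that on \<open>b\<close> only the oscillation within the short edge enters.\<close>
  define r where "r = \<phi> (tail G b)"
  have cf: "continuous_on {0..?l e} (f e)" "continuous_on {0..?l e} (f' e)" if "e \<in> arcs G" for e
    by (rule DERIV_continuous_on, erule f1[OF that], rule DERIV_continuous_on, erule f2[OF that])
  have nonneg: "0 \<le> integral {0..?l e} (\<lambda>x. (f' e x)\<^sup>2)" if "e \<in> arcs G" for e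
    by (intro integral_nonneg integrable_continuous_real continuous_intros cf that) auto
  have "E \<ge> 0" unfolding E_def by (intro sum_nonneg nonneg)
  have osc: "(f e y - f e x)\<^sup>2 \<le> ?l e * E"
    if "e \<in> arcs G" "x \<in> {0..?l e}" "y \<in> {0..?l e}" for e x y
  proof -
    have "(f e y - f e x)\<^sup>2 \<le> ?l e * integral {0..?l e} (\<lambda>x. (f' e x)\<^sup>2)"
      using that cf by (intro square_diff_le_energy f1) auto
    also have "\<dots> \<le> ?l e * E"
      unfolding E_def using that l[of e] nonneg by (intro mult_left_mono member_le_sum) auto
    finally show ?thesis .
  qed
  have osc': "\<bar>f e y - f e x\<bar> \<le> sqrt E"
    if "e \<in> arcs G" "x \<in> {0..?l e}" "y \<in> {0..?l e}" for e x y
  proof -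
    have "?l e * E \<le> 1 * E" using l[of e] \<open>E \<ge> 0\<close> by (intro mult_right_mono) auto
    with osc[OF that] have "(f e y - f e x)\<^sup>2 \<le> E" by simp
    then show ?thesis by (metis real_sqrt_abs real_sqrt_le_mono)
  qed
  \<comment> \<open>N steps of size sqrt E lead from the tail of \<open>b\<close> to the tail of e,
    and one more leads to x within e.\<close>
  have dev: "\<bar>f e x - r\<bar> \<le> (N + 1) * sqrt E" if e: "e \<in> arcs G" and x: "x \<in> {0..?l e}" for e x
  proof -
    have "\<bar>\<phi> (head G a) - \<phi> (tail G a)\<bar> \<le> sqrt E" if "a \<in> arcs G" for a
      using osc'[OF that, of 0 "?l a"] \<phi>[OF that] l[of a] by simp
    then have "\<bar>\<phi> (tail G e) - \<phi> (tail G b)\<bar> \<le> N * sqrt E"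
      using \<open>E \<ge> 0\<close> e b by (intro N) auto
    moreover have "\<bar>f e x - \<phi> (tail G e)\<bar> \<le> sqrt E"
      using osc'[OF e _ x, of 0] \<phi>[OF e] l[of e] by simp
    ultimately show ?thesis by (simp add: r_def algebra_simps)
  qed
  have edge: "c e * integral {0..?l e} (\<lambda>x. (f e x - r)\<^sup>2) \<le> \<delta> * (N + 1)\<^sup>2 * E"
    if e: "e \<in> arcs G" for e
  proof -
    \<comment> \<open>With c e = 1 / \<delta> and length \<delta> on \<open>b\<close>, the bound
      becomes \<delta> * E there; on the other edges the density \<delta> supplies the small
      factor.\<close>
    define B where "B = (if e = b then \<delta> * E else (N + 1)\<^sup>2 * E)"
    have "(f e x - r)\<^sup>2 \<le> B" if x: "x \<in> {0..?l e}" for x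
    proof (cases "e = b")
      case True
      then show ?thesis
        using osc[OF e _ x, of 0] \<phi>[OF b] x \<delta> by (simp add: B_def r_def g_def edge_length_spike)
    next
      case False
      have "\<bar>f e x - r\<bar>\<^sup>2 \<le> ((N + 1) * sqrt E)\<^sup>2"
        by (intro power_mono dev e x) auto
      then show ?thesis using False \<open>E \<ge> 0\<close> by (simp add: B_def power_mult_distrib)
    qed
    then have "integral {0..?l e} (\<lambda>x. (f e x - r)\<^sup>2) \<le> integral {0..?l e} (\<lambda>x. B)"
      by (intro integral_le integrable_continuous_real continuous_intros cf e) auto
    also have "\<dots> = ?l e * B" using l[of e] by simp
    finally have "c e * integral {0..?l e} (\<lambda>x. (f e x - r)\<^sup>2) \<le> c e * (?l e * B)"
      using c[of e] by (intro mult_left_mono) auto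
    also have "\<dots> \<le> \<delta> * (N + 1)\<^sup>2 * E"
    proof (cases "e = b")
      case True
      have "1\<^sup>2 \<le> (N + 1)\<^sup>2" using \<open>N \<ge> 0\<close> by (intro power_mono) auto
      then have "\<delta> * 1 * E \<le> \<delta> * (N + 1)\<^sup>2 * E"
        using \<delta> \<open>E \<ge> 0\<close> by (intro mult_right_mono mult_left_mono) auto
      then show ?thesis using True \<delta>
        by (simp add: B_def c_def g_def edge_length_spike power2_eq_square)
    next
      case False
      then show ?thesis using \<delta> by (simp add: B_def c_def g_def edge_length_spike)
    qed
    finally show ?thesis .
  qed
  have "E = 0"
  proof (cases "\<mu> > 0")
    case True
    with mean have mean0: "(\<Sum>e\<in>arcs G. c e * integral {0..?l e} (f e)) = 0" by simp
    have expand: "c e * integral {0..?l e} (\<lambda>x. (f e x - r)\<^sup>2) =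
        c e * integral {0..?l e} (\<lambda>x. (f e x)\<^sup>2) - 2 * r * (c e * integral {0..?l e} (f e))
        + c e * (?l e * r\<^sup>2)" if e: "e \<in> arcs G" for e
    proof -
      have "f e integrable_on {0..?l e}" "(\<lambda>x. (f e x)\<^sup>2) integrable_on {0..?l e}"
        by (intro integrable_continuous_real continuous_intros cf e)+
      moreover have "((\<lambda>x. r\<^sup>2) has_integral (?l e * r\<^sup>2)) {0..?l e}"
        using has_integral_const_real[of "r\<^sup>2" 0 "?l e"] l[of e] by simp
      ultimately have "((\<lambda>x. (f e x)\<^sup>2 - 2 * r * f e x + r\<^sup>2) has_integral
          (integral {0..?l e} (\<lambda>x. (f e x)\<^sup>2) - 2 * r * integral {0..?l e} (f e) + ?l e * r\<^sup>2)) {0..?l e}"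
        by (intro has_integral_add has_integral_diff has_integral_mult_right integrable_integral)
      moreover have "(\<lambda>x. (f e x)\<^sup>2 - 2 * r * f e x + r\<^sup>2) = (\<lambda>x. (f e x - r)\<^sup>2)"
        by (auto simp: power2_eq_square algebra_simps)
      ultimately have "((\<lambda>x. (f e x - r)\<^sup>2) has_integral
          (integral {0..?l e} (\<lambda>x. (f e x)\<^sup>2) - 2 * r * integral {0..?l e} (f e) + ?l e * r\<^sup>2)) {0..?l e}"
        by simp
      then show ?thesis by (subst integral_unique) (auto simp: algebra_simps)
    qed
    have "0 \<le> (\<Sum>e\<in>arcs G. c e * (?l e * r\<^sup>2))"
      using c l by (intro sum_nonneg) (simp add: less_imp_le)
    \<comment> \<open>Since the weighted mean of f is zero, the cross term vanishes, and the second
      moment about 0 is at most the one about r.\<close>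
    then have "(\<Sum>e\<in>arcs G. c e * integral {0..?l e} (\<lambda>x. (f e x)\<^sup>2))
        \<le> (\<Sum>e\<in>arcs G. c e * integral {0..?l e} (\<lambda>x. (f e x - r)\<^sup>2))"
      by (simp add: expand sum.distrib sum_subtractf mean0 flip: sum_distrib_left)
    also have "\<dots> \<le> (\<Sum>e\<in>arcs G. \<delta> * (N + 1)\<^sup>2 * E)"
      by (intro sum_mono edge)
    finally have "E \<le> \<mu> * (card (arcs G) * (\<delta> * (N + 1)\<^sup>2 * E))"
      using True energy by (simp add: E_def)
    then have "E * (1 - \<mu> * (\<delta> * (card (arcs G) * (N + 1)\<^sup>2))) \<le> 0"
      by (simp add: algebra_simps)
    with \<mu> \<open>E \<ge> 0\<close> show ?thesis by (auto simp: mult_le_0_iff)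
  next
    case False
    \<comment> \<open>For \<mu> \<le> 0 the energy identity alone gives E \<le> 0.\<close>
    have "0 \<le> integral {0..?l e} (\<lambda>x. (f e x)\<^sup>2)" if "e \<in> arcs G" for e
      by (intro integral_nonneg integrable_continuous_real continuous_intros cf that) auto
    then have "0 \<le> (\<Sum>e\<in>arcs G. c e * integral {0..?l e} (\<lambda>x. (f e x)\<^sup>2))"
      using c by (intro sum_nonneg mult_nonneg_nonneg) (auto intro: less_imp_le)
    with False have "E \<le> 0" unfolding E_def energy by (simp add: mult_nonpos_nonneg)
    with \<open>E \<ge> 0\<close> show ?thesis by simp
  qed
  then have const: "f e x = r" if "e \<in> arcs G" "x \<in> {0..?l e}" for e x
    using dev[OF that] by simp
  \<comment> \<open>The constant r has weighted integral r times the total mass, which must vanish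
    when \<mu> is nonzero.\<close>
  have "r = 0" if "\<mu> \<noteq> 0"
  proof -
    have "integral {0..?l e} (f e) = ?l e * r" if "e \<in> arcs G" for e
      using integral_cong[of "{0..?l e}" "f e" "\<lambda>_. r"] const[OF that] l[of e] by simp
    then have "(\<Sum>e\<in>arcs G. c e * ?l e) * r = 0"
      using mean \<open>\<mu> \<noteq> 0\<close> by (simp add: sum_distrib_right mult.assoc)
    moreover have "(\<Sum>e\<in>arcs G. c e * ?l e) > 0"
      using c l b by (intro sum_pos) auto
    ultimately show ?thesis by simp
  qed
  moreover have "f = edge_fun G g (\<lambda>e x. r)"
    using f const by (auto simp: fun_eq_iff edge_fun_def eigenspace_def g_def)
  ultimately show thesis using that by (simp add: g_def)
qed

section \<open>Explicit eigenfunctions and finite-dimensionality\<close>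

lemma spike_constant_eigenfunction:
  assumes "\<delta> > 0"
  shows "edge_fun G (spike_metric b \<delta>) (\<lambda>e x. 1) \<in> eigenspace G (spike_metric b \<delta>) (spike_density b \<delta>) 0"
  using assms
  by (intro edge_funI_eigenspace[where h' = "\<lambda>e x. 0" and \<phi> = "\<lambda>_. 1"])
     (auto simp: spike_metric_in_metrics)

text \<open>A full period on each edge has value 1 and slope 0 at both ends, so the vertex
  conditions hold on any graph. The eigenvalue solves (2 * pi / \<ell>)^2 = \<mu> * \<delta> /
  \<ell>^2.\<close>

lemma spike_cosine_eigenfunction:
  assumes "\<delta> > 0"
  shows "edge_fun G (spike_metric b \<delta>) (\<lambda>e x. cos (2 * pi / edge_length (spike_metric b \<delta>) e * x))
     \<in> eigenspace G (spike_metric b \<delta>) (spike_density b \<delta>) (4 * pi\<^sup>2 / \<delta>)"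
proof -
  have nz: "edge_length (spike_metric b \<delta>) e \<noteq> 0" for e
    using edge_length_spike_pos[OF assms, of b e] by simp
  show ?thesis
    using nz assms
    by (intro edge_funI_eigenspace[where \<phi> = "\<lambda>_. 1" and
          h' = "\<lambda>e x. - (2 * pi / edge_length (spike_metric b \<delta>) e *
                   sin (2 * pi / edge_length (spike_metric b \<delta>) e * x))"])
       (auto simp: spike_metric_in_metrics arclength_density_spike power2_eq_square
             intro!: derivative_eq_intros)
qed

text \<open>This supplies the finiteness for \<open>dim_pos_if_finite_span\<close>. On each edge f
  solves an oscillator equation with constant coefficients, so two functions per edge
  suffice.\<close>

lemma spike_eigenspace_finite_span:
  fixes G :: "('v, 'e) pre_digraph"
  assumes "fin_digraph G" and \<delta>: "\<delta> > 0" and "\<mu> > 0"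
  obtains B where "finite B" "eigenspace G (spike_metric b \<delta>) (spike_density b \<delta>) \<mu> \<subseteq> graph_fun.span B"
proof -
  interpret fin_digraph G by fact
  define g where "g = spike_metric b \<delta>"
  define k where "k e = sqrt (\<mu> * \<delta>) / edge_length g e" for e
  \<comment> \<open>\<open>C a\<close> and \<open>S a\<close> live on the single edge a and may
    violate the vertex conditions; only a finite spanning set is wanted, not a basis of the
    eigenspace.\<close>
  define C where "C a = edge_fun G g (\<lambda>e x. if e = a then cos (k e * x) else 0)" for a
  define S where "S a = edge_fun G g (\<lambda>e x. if e = a then sin (k e * x) else 0)" for a
  let ?B = "C ` arcs G \<union> S ` arcs G"
  have k: "k e \<noteq> 0" "(k e)\<^sup>2 = \<mu> * arclength_density g (spike_density b \<delta>) e x" for e x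
    using \<delta> \<open>\<mu> > 0\<close> edge_length_spike_pos[OF \<delta>, of b e]
    by (simp_all add: k_def g_def arclength_density_spike power_divide)
  have "f \<in> graph_fun.span ?B" if f: "f \<in> eigenspace G g (spike_density b \<delta>) \<mu>" for f
  proof -
    have "g \<in> metrics G" using \<delta> by (simp add: g_def spike_metric_in_metrics)
    note data = eigenspace_energyE[OF \<open>fin_digraph G\<close> this f, folded k(2)]
    obtain f' where
      f1: "\<And>e x. e \<in> arcs G \<Longrightarrow> x \<in> {0..edge_length g e} \<Longrightarrow>
       (f e has_real_derivative f' e x) (at x within {0..edge_length g e})"
      and f2: "\<And>e x. e \<in> arcs G \<Longrightarrow> x \<in> {0..edge_length g e} \<Longrightarrow>
       (f' e has_real_derivative - ((k e)\<^sup>2 * f e x)) (at x within {0..edge_length g e})"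
      by (rule data) blast
    define F where "F a = (\<lambda>e x. f a 0 * C a e x) + (\<lambda>e x. f' a 0 / k a * S a e x)" for a
    have sum_apply: "(\<Sum>a\<in>A. F a) e x = (\<Sum>a\<in>A. F a e x)" for A e x
      by (induction A rule: infinite_finite_induct) auto
    have "f e x = (\<Sum>a\<in>arcs G. F a e x)" for e x
    proof (cases "e \<in> arcs G \<and> x \<in> {0..edge_length g e}")
      case True
      have "(\<Sum>a\<in>arcs G. F a e x) = (\<Sum>a\<in>arcs G. if a = e then F e e x else 0)"
        by (intro sum.cong) (auto simp: F_def C_def S_def edge_fun_def)
      also have "\<dots> = f e 0 * cos (k e * x) + f' e 0 / k e * sin (k e * x)"
        using True by (simp add: F_def C_def S_def edge_fun_def)
      also have "\<dots> = f e x"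
        using True k(1) by (intro harmonic_oscillator_unique[symmetric, OF f1 f2]) auto
      finally show ?thesis ..
    next
      case False
      moreover from this f have "f e x = 0" unfolding eigenspace_def by blast
      moreover have "F a e x = 0" for a using False by (auto simp: F_def C_def S_def edge_fun_def)
      ultimately show ?thesis by simp
    qed
    then have "f = (\<Sum>a\<in>arcs G. F a)" by (simp add: fun_eq_iff sum_apply)
    moreover have "F a \<in> graph_fun.span ?B" if "a \<in> arcs G" for a
      unfolding F_def
      by (intro graph_fun.span_add graph_fun.span_scale graph_fun.span_base) (use that in auto)
    ultimately show ?thesis by (simp add: graph_fun.span_sum)
  qed
  then show thesis by (intro that[of ?B]) (auto simp: g_def)
qed

section \<open>The first eigenvalue and the supremum\<close>

text \<open>Below the threshold only \<mu> = 0 contributes, with multiplicity at most 1, whereas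
  index 1 requires a total multiplicity above 1.\<close>

lemma spike_nth_eigenvalue_ge:
  fixes G :: "('v, 'e) pre_digraph" and \<delta> N :: real
  assumes "fin_digraph G" and b: "b \<in> arcs G" and \<delta>: "\<delta> > 0" "\<delta> \<le> 1" and "N \<ge> 0"
    and N: "\<And>(\<phi> :: 'v \<Rightarrow> real) s u v. \<lbrakk>\<And>e. e \<in> arcs G \<Longrightarrow> \<bar>\<phi> (head G e) - \<phi> (tail G e)\<bar> \<le> s; s \<ge> 0;
       u \<in> verts G; v \<in> verts G\<rbrakk> \<Longrightarrow> \<bar>\<phi> u - \<phi> v\<bar> \<le> N * s"
  shows "1 / (\<delta> * (card (arcs G) * (N + 1)\<^sup>2)) \<le> nth_eigenvalue G 1 (spike_metric b \<delta>) (spike_density b \<delta>)"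
proof -
  interpret fin_digraph G by fact
  define D where "D = \<delta> * (card (arcs G) * (N + 1)\<^sup>2)"
  let ?g = "spike_metric b \<delta>" and ?\<rho> = "spike_density b \<delta>"
  let ?one = "edge_fun G ?g (\<lambda>e x. 1)"
  have "card (arcs G) > 0" using b by (auto simp: card_gt_0_iff)
  then have "D > 0" using \<delta> \<open>N \<ge> 0\<close> by (simp add: D_def)
  have small: "\<exists>r. f = edge_fun G ?g (\<lambda>e x. r) \<and> (\<mu> \<noteq> 0 \<longrightarrow> r = 0)"
    if "f \<in> eigenspace G ?g ?\<rho> \<mu>" "\<mu> < 1 / D" for f \<mu>
  proof -
    have "\<mu> * D < 1" using that \<open>D > 0\<close> by (simp add: field_simps)
    from spike_eigenfunction_constant[OF \<open>fin_digraph G\<close> b \<delta> \<open>N \<ge> 0\<close> N that(1) this[unfolded D_def]]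
    show ?thesis by blast
  qed
  have span: "eigenspace G ?g ?\<rho> 0 \<subseteq> graph_fun.span {?one}"
  proof
    fix f assume "f \<in> eigenspace G ?g ?\<rho> 0"
    then obtain r where "f = edge_fun G ?g (\<lambda>e x. r)"
      using small[of f 0] \<open>D > 0\<close> by auto
    then have "f = (\<lambda>e x. r * ?one e x)" by (auto simp: edge_fun_def fun_eq_iff)
    then show "f \<in> graph_fun.span {?one}"
      by (auto intro: graph_fun.span_scale graph_fun.span_base)
  qed
  have mult_0: "multiplicity_of G ?g ?\<rho> 0 \<le> 1"
    unfolding multiplicity_of_def using graph_fun.dim_le_card[OF span] by simp
  have mult_small: "multiplicity_of G ?g ?\<rho> \<mu> = 0" if "\<mu> < 1 / D" "\<mu> \<noteq> 0" for \<mu>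
  proof -
    have "eigenspace G ?g ?\<rho> \<mu> \<subseteq> graph_fun.span {}"
      using small that by (fastforce simp: edge_fun_def fun_eq_iff)
    from graph_fun.dim_le_card[OF this] show ?thesis by (simp add: multiplicity_of_def)
  qed
  have nz: "edge_fun G ?g h \<noteq> 0" if "h b 0 \<noteq> 0" for h
    using that b edge_length_spike_pos[OF \<delta>(1), of b b]
    by (auto simp: edge_fun_def fun_eq_iff intro!: exI[of _ b] exI[of _ 0])
  have "0 < multiplicity_of G ?g ?\<rho> 0"
    unfolding multiplicity_of_def
    by (rule dim_pos_if_finite_span[OF _ span spike_constant_eigenfunction[OF \<open>\<delta> > 0\<close>] nz]) auto
  moreover have "0 < multiplicity_of G ?g ?\<rho> (4 * pi\<^sup>2 / \<delta>)"
  proof -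
    obtain B where "finite B" "eigenspace G ?g ?\<rho> (4 * pi\<^sup>2 / \<delta>) \<subseteq> graph_fun.span B"
      using spike_eigenspace_finite_span[OF \<open>fin_digraph G\<close> \<delta>(1)] \<delta>(1)
      by (metis divide_pos_pos mult_pos_pos pi_gt_zero zero_less_numeral zero_less_power)
    then show ?thesis
      unfolding multiplicity_of_def
      by (rule dim_pos_if_finite_span[OF _ _ spike_cosine_eigenfunction[OF \<open>\<delta> > 0\<close>] nz]) auto
  qed
  ultimately have "1 < (\<Sum>\<mu>\<in>{0, 4 * pi\<^sup>2 / \<delta>}. multiplicity_of G ?g ?\<rho> \<mu>)"
    using \<delta> by simp
  \<comment> \<open>The set under the infimum is nonempty, as \<open>cInf_greatest\<close>
    demands.\<close>
  then have "4 * pi\<^sup>2 / \<delta> \<in> {c. \<exists>M. finite M \<and> M \<subseteq> {..c} \<and> 1 < (\<Sum>\<mu>\<in>M. multiplicity_of G ?g ?\<rho> \<mu>)}"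
    using \<delta> by (intro CollectI exI[of _ "{0, 4 * pi\<^sup>2 / \<delta>}"]) auto
  moreover have "1 / D \<le> c"
    if M: "finite M" "M \<subseteq> {..c}" "1 < (\<Sum>\<mu>\<in>M. multiplicity_of G ?g ?\<rho> \<mu>)" for c M
  proof (rule ccontr)
    assume "\<not> 1 / D \<le> c"
    then have "(\<Sum>\<mu>\<in>M. multiplicity_of G ?g ?\<rho> \<mu>) = (\<Sum>\<mu>\<in>M \<inter> {0}. multiplicity_of G ?g ?\<rho> \<mu>)"
      using M by (intro sum.mono_neutral_right) (auto intro!: mult_small)
    also have "\<dots> \<le> 1" using mult_0 by (cases "0 \<in> M") auto
    finally show False using M by simp
  qed
  ultimately have "1 / D \<le> nth_eigenvalue G 1 ?g ?\<rho>"
    unfolding nth_eigenvalue_def by (intro cInf_greatest) auto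
  then show ?thesis by (simp add: D_def)
qed

theorem theorem5p6:
  fixes G :: "('v, 'e) pre_digraph"
  assumes "fin_digraph G"
    and "Digraph_Component.connected G"
    and "card (arcs G) \<ge> 2"
  shows "(SUP (g, \<rho>)\<in>admissible G. ereal (normalized_eigenvalue G 1 g \<rho>)) = \<infinity>"
proof (rule ereal_top)
  fix K :: real
  interpret fin_digraph G by fact
  obtain N :: real where "N \<ge> 0" and
    N: "\<And>(\<phi> :: 'v \<Rightarrow> real) s u v. \<lbrakk>\<And>e. e \<in> arcs G \<Longrightarrow> \<bar>\<phi> (head G e) - \<phi> (tail G e)\<bar> \<le> s; s \<ge> 0;
       u \<in> verts G; v \<in> verts G\<rbrakk> \<Longrightarrow> \<bar>\<phi> u - \<phi> v\<bar> \<le> N * s"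
    using connected_variation_bound[OF assms(1,2)] by blast
  \<comment> \<open>The second edge \<open>a\<close> keeps length 1; if \<open>b\<close> were the
    only edge, the total length would shrink with \<delta>.\<close>
  obtain b a where ab: "b \<in> arcs G" "a \<in> arcs G" "a \<noteq> b"
    using assms(3) by (metis card_2_iff' card_le_Suc0_iff_eq finite_arcs not_less_eq_eq numeral_2_eq_2)
  define C where "C = card (arcs G) * (N + 1)\<^sup>2"
  \<comment> \<open>This makes the bound 1 / (\<delta> * C) equal to max 1 K. The maximum with 1
    ensures \<delta> \<le> 1 and keeps the factors nonnegative in the final product.\<close>
  define \<delta> where "\<delta> = 1 / (C * max 1 K)"
  let ?g = "spike_metric b \<delta>" and ?\<rho> = "spike_density b \<delta>"
  have "1 * 1\<^sup>2 \<le> C"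
    unfolding C_def using assms(3) \<open>N \<ge> 0\<close> by (intro mult_mono power_mono) auto
  moreover from this have "1 * 1 \<le> C * max 1 K" by (intro mult_mono) auto
  ultimately have C: "C \<ge> 1" and \<delta>: "\<delta> > 0" "\<delta> \<le> 1" by (auto simp: \<delta>_def)
  have "1 / (\<delta> * C) \<le> nth_eigenvalue G 1 ?g ?\<rho>"
    unfolding C_def by (rule spike_nth_eigenvalue_ge[OF assms(1) ab(1) \<delta> \<open>N \<ge> 0\<close> N])
  moreover have "1 / (\<delta> * C) = max 1 K" using C by (simp add: \<delta>_def)
  ultimately have \<lambda>: "max 1 K \<le> nth_eigenvalue G 1 ?g ?\<rho>" by simp
  have "edge_length ?g a \<le> total_length G ?g"
    unfolding total_length_def using ab \<delta>
    by (intro member_le_sum) (auto intro: less_imp_le[OF edge_length_spike_pos])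
  then have L: "1 \<le> total_length G ?g" using ab \<delta> by (simp add: edge_length_spike)
  have mass: "integral {0..edge_length ?g e} (arclength_density ?g ?\<rho> e) = \<delta> / edge_length ?g e" for e
  proof -
    have "arclength_density ?g ?\<rho> e = (\<lambda>x. \<delta> / (edge_length ?g e)\<^sup>2)"
      using \<delta> by (simp add: fun_eq_iff arclength_density_spike)
    then show ?thesis
      using edge_length_spike_pos[OF \<delta>(1), of b e] by (simp add: power2_eq_square)
  qed
  \<comment> \<open>The edge \<open>b\<close> alone carries mass \<delta> / \<delta> = 1.\<close>
  have "\<delta> / edge_length ?g b \<le> total_mass G ?g ?\<rho>"
    unfolding total_mass_def mass using ab \<delta>
    by (intro member_le_sum) (auto intro!: less_imp_le[OF divide_pos_pos] edge_length_spike_pos)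
  then have M: "1 \<le> total_mass G ?g ?\<rho>" using \<delta> by (simp add: edge_length_spike)
  have "max 1 K * 1 * 1 \<le> normalized_eigenvalue G 1 ?g ?\<rho>"
    unfolding normalized_eigenvalue_def using \<lambda> L M by (intro mult_mono) auto
  then have "ereal K \<le> ereal (normalized_eigenvalue G 1 ?g ?\<rho>)" by simp
  also have "\<dots> \<le> (SUP (g, \<rho>)\<in>admissible G. ereal (normalized_eigenvalue G 1 g \<rho>))"
    using spike_admissible[OF \<open>\<delta> > 0\<close>, of b G] by (intro SUP_upper2) auto
  finally show "ereal K \<le> (SUP (g, \<rho>)\<in>admissible G. ereal (normalized_eigenvalue G 1 g \<rho>))" .
qed

end
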